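(* Let $E$ be a graph such that $E^0$ is finite, and let $\sigma$ be an automorphism of $E$. Then: (1) $E$ is acyclic if and only if $E_{\sigma}$ is acyclic; (2) every cycle in $E$ has an exit if and only if every cycle in $E_{\sigma}$ has an exit; (3) $E$ is a no-exit graph if and only if $E_{\sigma}$ is a no-exit graph; (4) $E$ satisfies Condition $(\mathrm K)$ if and only if $E_\sigma$ satisfies Condition $(\mathrm K)$.
   Context: A graph $E=(E^0,E^1,s,r)$ consists of disjoint sets $E^0$ (vertices) and $E^1$ (edges; possibly infinite) and maps $s,r\colon E^1\to E^0$. An automorphism of $E$ is a pair $\sigma=(\sigma_0,\sigma_1)$ of bijections of $E^0$ and $E^1$ with $s\circ\sigma_1=\sigma_0\circ s$, $r\circ\sigma_1=\sigma_0\circ r$. The twisted graph is $E_\sigma=(E^0,E^1,s,r_\sigma)$ with $r_\sigma=\sigma_0^{-1}\circ r$. A path of length $n\ge1$ is a word $p=e_1\cdots e_n$ of edges with $r(e_i)=s(e_{i+1})$; $s(p)=s(e_1)$, $r(p)=r(e_n)$. A closed path based at $v$ is a path of positive length with $s(p)=r(p)=v$. A closed simple path based at $v$ is a closed path $e_1\cdots e_n$ based at $v$ with $s(e_i)\ne v$ for $1<i\le n$. A cycle based at $v$ is a closed path $e_1\cdots e_n$ based at $v$ with $s(e_i)\neq s(e_j)$ for $i\ne j$. A graph is acyclic if it has no cycles. An edge $f$ is an exit for a path $e_1\cdots e_n$ if there is $i$ with $s(e_i)=s(f)$ and $e_i\ne f$. A graph is a no-exit graph if no cycle in it has an exit. A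 graph satisfies Condition $(\mathrm K)$ if for each vertex $v$ which lies on a closed simple path there exist at least two distinct closed simple paths based at $v$. *)

theory Defs
  imports "Graph_Theory.Arc_Walk"
begin

(* A graph (E0, E1, s, r) is a pre_digraph satisfying wf_digraph: s is tail, r is head, and
   parallel edges, loops and infinite edge sets are allowed.  A path p of positive length from
   u to v is awalk u p v with p non-empty. *)

definition digraph_automorphism ::
    "('a, 'b) pre_digraph \<Rightarrow> ('a \<Rightarrow> 'a) \<Rightarrow> ('b \<Rightarrow> 'b) \<Rightarrow> bool" where
  "digraph_automorphism G \<sigma>0 \<sigma>1 \<longleftrightarrow>
     bij_betw \<sigma>0 (verts G) (verts G) \<and> bij_betw \<sigma>1 (arcs G) (arcs G) \<and>
     (\<forall>e \<in> arcs G. tail G (\<sigma>1 e) = \<sigma>0 (tail G e)) \<and>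
     (\<forall>e \<in> arcs G. head G (\<sigma>1 e) = \<sigma>0 (head G e))"

(* Only the vertex part of an automorphism enters; the inverse is the one on verts G. *)
definition twisted_graph :: "('a, 'b) pre_digraph \<Rightarrow> ('a \<Rightarrow> 'a) \<Rightarrow> ('a, 'b) pre_digraph" where
  "twisted_graph G \<sigma>0 = G\<lparr>head := (\<lambda>e. the_inv_into (verts G) \<sigma>0 (head G e))\<rparr>"

definition closed_path :: "('a, 'b) pre_digraph \<Rightarrow> 'a \<Rightarrow> 'b list \<Rightarrow> bool" where
  "closed_path G v p \<longleftrightarrow> p \<noteq> [] \<and> pre_digraph.awalk G v p v"

(* Lists are indexed from 0, so the base edge is p ! 0. *)
definition closed_simple_path :: "('a, 'b) pre_digraph \<Rightarrow> 'a \<Rightarrow> 'b list \<Rightarrow> bool" where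
  "closed_simple_path G v p \<longleftrightarrow>
     closed_path G v p \<and> (\<forall>i. 0 < i \<and> i < length p \<longrightarrow> tail G (p ! i) \<noteq> v)"

definition cycle_at :: "('a, 'b) pre_digraph \<Rightarrow> 'a \<Rightarrow> 'b list \<Rightarrow> bool" where
  "cycle_at G v p \<longleftrightarrow> closed_path G v p \<and> distinct (map (tail G) p)"

definition is_exit :: "('a, 'b) pre_digraph \<Rightarrow> 'b \<Rightarrow> 'b list \<Rightarrow> bool" where
  "is_exit G f p \<longleftrightarrow> f \<in> arcs G \<and> (\<exists>e \<in> set p. tail G e = tail G f \<and> e \<noteq> f)"

definition acyclic_graph :: "('a, 'b) pre_digraph \<Rightarrow> bool" where
  "acyclic_graph G \<longleftrightarrow> \<not> (\<exists>v p. cycle_at G v p)"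

definition every_cycle_has_exit :: "('a, 'b) pre_digraph \<Rightarrow> bool" where
  "every_cycle_has_exit G \<longleftrightarrow> (\<forall>v p. cycle_at G v p \<longrightarrow> (\<exists>f. is_exit G f p))"

definition no_exit_graph :: "('a, 'b) pre_digraph \<Rightarrow> bool" where
  "no_exit_graph G \<longleftrightarrow> \<not> (\<exists>v p. cycle_at G v p \<and> (\<exists>f. is_exit G f p))"

(* The closed simple path that v lies on may be based at any vertex u. *)
definition condition_K :: "('a, 'b) pre_digraph \<Rightarrow> bool" where
  "condition_K G \<longleftrightarrow>
     (\<forall>v \<in> verts G.
        (\<exists>u p. closed_simple_path G u p \<and> v \<in> set (pre_digraph.awalk_verts G u p)) \<longrightarrow>
        (\<exists>p q. p \<noteq> q \<and> closed_simple_path G v p \<and> closed_simple_path G v q))"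

end

theory Submission
  imports Defs
begin

text \<open>
  Twisting changes only the heads of the arcs, and moves each head within its \<open>\<sigma>0\<close>-orbit.
  The proof therefore describes all four properties by data that are not affected by such a move.

  Call an arc \<^emph>\<open>cyclic\<close> if its head reaches its tail, that is, if it lies on a closed path. The set
  of cyclic arcs is the same in \<open>E\<close> and in its twist: a path of one graph becomes a path
  of the other, with the same first arc, when each later arc is replaced by a suitable translate
  under \<open>\<sigma>1\<close>. So if \<open>e\<close> is cyclic with tail \<open>x\<close>, then in the other graph the head of \<open>e\<close> still reaches
  some translate \<open>(\<sigma>0 ^^ m) x\<close>. As the vertex set is finite, a vertex that reaches a translate of
  itself is reached back from there, and \<open>e\<close> is cyclic in the other graph as well
  (\<open>cyclic_arcs_subset\<close>).

  In terms of cyclic arcs, a graph is acyclic iff it has no cyclic arc, and it is a no-exit graph iff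
  each cyclic arc is the only arc that starts at its tail. For the other two properties, let a
  \<^emph>\<open>trap\<close> for a set \<open>A\<close> of arcs be a nonempty set of vertices, each of which
  emits exactly one arc of \<open>A\<close>, with that arc ending in the set again. Some cycle has no exit iff there
  is a trap for the set of all arcs, and Condition (K) fails iff there is a trap for the set of cyclic
  arcs (\<open>every_cycle_has_exit_iff\<close>, \<open>condition_K_iff\<close>). Finally, the union of the translates of a
  trap is a trap of the other graph, because it is a union of orbits and hence does not notice that
  heads move within their orbits (\<open>trap_translates\<close>).
\<close>

section \<open>Cyclic arcs and traps\<close>

definition cyclic_arcs :: "('a, 'b) pre_digraph \<Rightarrow> 'b set" where
  "cyclic_arcs G = {e \<in> arcs G. head G e \<rightarrow>\<^sup>*\<^bsub>G\<^esub> tail G e}"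

text \<open>The arc set \<open>A\<close> is a parameter because exits concern all arcs, whereas Condition (K) only
  sees the arcs that lie on closed paths.\<close>

definition trap :: "('a, 'b) pre_digraph \<Rightarrow> 'b set \<Rightarrow> 'a set \<Rightarrow> bool" where
  "trap G A X \<longleftrightarrow> X \<subseteq> verts G \<and> X \<noteq> {} \<and>
     (\<forall>x\<in>X. \<exists>e\<in>A. tail G e = x \<and> head G e \<in> X \<and> (\<forall>f\<in>A. tail G f = x \<longrightarrow> f = e))"

lemma cyclic_arcs_subset_arcs: "cyclic_arcs G \<subseteq> arcs G"
  by (auto simp: cyclic_arcs_def)

lemma trap_obtain_arc:
  assumes "trap G A X" "x \<in> X"
  obtains e where "e \<in> A" "tail G e = x" "head G e \<in> X" "\<And>f. f \<in> A \<Longrightarrow> tail G f = x \<Longrightarrow> f = e"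
  using assms unfolding trap_def by metis

context wf_digraph
begin

lemma reachable_finite:
  assumes "finite (verts G)"
  shows "finite {y. x \<rightarrow>\<^sup>* y}"
  by (rule finite_subset[OF _ assms]) (auto dest: reachable_in_verts)

lemma arc_reachable: "e \<in> arcs G \<Longrightarrow> tail G e \<rightarrow>\<^sup>* head G e"
  by (metis arc_implies_awalk reachable_awalkI)

lemma closed_path_tail_mem:
  assumes "closed_path G v p"
  shows "v \<in> tail G ` set p"
  using assms by (cases p) (auto simp: closed_path_def awalk_Cons_iff)

lemma closed_path_arc_cyclic:
  assumes "closed_path G v p" "e \<in> set p"
  shows "e \<in> cyclic_arcs G"
proof -
  obtain q r where p: "p = q @ e # r" using assms(2) by (auto dest: split_list)
  have "awalk v (q @ e # r) v" using assms(1) p by (simp add: closed_path_def)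
  then have *: "awalk v q (tail G e)" "e \<in> arcs G" "awalk (head G e) r v"
    by (auto simp: awalk_Cons_iff)
  then have "head G e \<rightarrow>\<^sup>* tail G e"
    by (meson awalk_appendI reachable_awalkI)
  with * show ?thesis by (simp add: cyclic_arcs_def)
qed

lemma awalk_tails_subset: "awalk u p v \<Longrightarrow> tail G ` set p \<subseteq> set (awalk_verts u p)"
  by (auto simp: awalk_verts_arc1)

text \<open>The tails of a nonempty path are its vertices without the last one; hence a path without
  repeated vertices meets its end only at the end.\<close>

lemma apath_tails:
  assumes "apath u p v"
  shows "distinct (map (tail G) p)" "v \<notin> tail G ` set p"
proof -
  have w: "awalk u p v" and d: "distinct (awalk_verts u p)"
    using assms by (auto simp: apath_def)
  show "distinct (map (tail G) p)" using d by (auto simp: awalk_verts_conv split: if_splits)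
  show "v \<notin> tail G ` set p"
  proof (cases "p = []")
    case False
    moreover have "awlast u p = v" using w by auto
    ultimately have "head G (last p) = v" by (simp add: awalk_verts_conv)
    with False d show ?thesis by (auto simp: awalk_verts_conv)
  qed simp
qed

lemma cyclic_arc_starts_cycle:
  assumes "e \<in> cyclic_arcs G"
  obtains p where "cycle_at G (tail G e) (e # p)"
proof -
  obtain p where p: "apath (head G e) p (tail G e)"
    using assms by (auto simp: cyclic_arcs_def reachable_apath)
  have "cycle_at G (tail G e) (e # p)"
    using assms apath_tails[OF p] awalkI_apath[OF p]
    by (auto simp: cycle_at_def closed_path_def awalk_Cons_iff cyclic_arcs_def)
  then show thesis by (rule that)
qed

text \<open>For induction on paths, the positions in the definition of a closed simple path are best
  replaced by its decomposition into the first arc and the rest.\<close>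

lemma closed_simple_path_Cons_iff:
  "closed_simple_path G v (e # p) \<longleftrightarrow>
     e \<in> arcs G \<and> tail G e = v \<and> awalk (head G e) p v \<and> v \<notin> tail G ` set p"
proof -
  have "(\<forall>i. 0 < i \<and> i < length (e # p) \<longrightarrow> tail G ((e # p) ! i) \<noteq> v) \<longleftrightarrow> v \<notin> tail G ` set p"
    (is "?L \<longleftrightarrow> ?R")
  proof
    assume L: ?L
    show ?R
    proof
      assume "v \<in> tail G ` set p"
      then obtain i where "i < length p" "tail G (p ! i) = v" by (auto simp: in_set_conv_nth)
      with L show False by (auto dest: spec[of _ "Suc i"])
    qed
  next
    assume ?R
    then show ?L by (auto simp: nth_Cons')
  qed
  then show ?thesis by (auto simp: closed_simple_path_def closed_path_def awalk_Cons_iff)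
qed

lemma cycle_imp_closed_simple_path:
  assumes "cycle_at G v p"
  shows "closed_simple_path G v p"
  using assms
  by (cases p) (auto simp: cycle_at_def closed_path_def closed_simple_path_Cons_iff awalk_Cons_iff)

section \<open>The four properties in terms of cyclic arcs and traps\<close>

lemma acyclic_graph_iff: "acyclic_graph G \<longleftrightarrow> cyclic_arcs G = {}"
proof -
  have "e \<notin> cyclic_arcs G" if "acyclic_graph G" for e
    using that by (metis acyclic_graph_def cyclic_arc_starts_cycle)
  moreover have "cyclic_arcs G \<noteq> {}" if c: "cycle_at G v p" for v p
  proof -
    have "closed_path G v p" "p \<noteq> []" using c by (auto simp: cycle_at_def closed_path_def)
    then show ?thesis using closed_path_arc_cyclic[of v p "hd p"] by auto
  qed
  ultimately show ?thesis by (auto simp: acyclic_graph_def)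
qed

lemma no_exit_graph_iff:
  "no_exit_graph G \<longleftrightarrow> (\<forall>e\<in>cyclic_arcs G. \<forall>f\<in>arcs G. tail G f = tail G e \<longrightarrow> f = e)"
  (is "_ \<longleftrightarrow> ?R")
proof
  assume noex: "no_exit_graph G"
  show ?R
  proof (intro ballI impI)
    fix e f assume e: "e \<in> cyclic_arcs G" and f: "f \<in> arcs G" "tail G f = tail G e"
    obtain p where "cycle_at G (tail G e) (e # p)" using e by (rule cyclic_arc_starts_cycle)
    with noex f show "f = e" by (fastforce simp: no_exit_graph_def is_exit_def)
  qed
next
  assume R: ?R
  show "no_exit_graph G"
    unfolding no_exit_graph_def is_exit_def cycle_at_def
    using R closed_path_arc_cyclic by metis
qed

text \<open>From a trap for all arcs no path escapes, so in a finite graph it contains a cycle, and a cycle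
  inside it has no exit. Conversely, the vertices of a cycle without exit form a trap.\<close>

lemma every_cycle_has_exit_iff:
  assumes fin: "finite (verts G)"
  shows "every_cycle_has_exit G \<longleftrightarrow> (\<nexists>X. trap G (arcs G) X)"
proof
  assume ex: "every_cycle_has_exit G"
  show "\<nexists>X. trap G (arcs G) X"
  proof
    assume "\<exists>X. trap G (arcs G) X"
    then obtain X where X: "trap G (arcs G) X" ..
    \<comment> \<open>A vertex of the trap that reaches as few vertices as possible is reached back from its
      successor, since the successor cannot reach fewer.\<close>
    define r where "r x = card {y. x \<rightarrow>\<^sup>* y}" for x
    obtain x0 where "x0 \<in> X" using X by (auto simp: trap_def)
    then obtain x where x: "x \<in> X" and min: "\<And>y. y \<in> X \<Longrightarrow> r x \<le> r y"
      using ex_has_least_nat[of "\<lambda>x. x \<in> X" x0 r] by blast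
    obtain e where e: "e \<in> arcs G" "tail G e = x" "head G e \<in> X"
      using trap_obtain_arc[OF X x] by metis
    have sub: "{y. head G e \<rightarrow>\<^sup>* y} \<subseteq> {y. x \<rightarrow>\<^sup>* y}"
      using arc_reachable[OF e(1)] e(2) by (auto intro: reachable_trans)
    have "{y. head G e \<rightarrow>\<^sup>* y} = {y. x \<rightarrow>\<^sup>* y}"
      using card_seteq[OF reachable_finite[OF fin] sub] min[OF e(3)] by (simp add: r_def)
    moreover have "x \<rightarrow>\<^sup>* x" using e(1,2) by auto
    ultimately have "head G e \<rightarrow>\<^sup>* tail G e" using e(2) by blast
    then have "e \<in> cyclic_arcs G" using e(1) by (simp add: cyclic_arcs_def)
    then obtain p where c: "cycle_at G (tail G e) (e # p)" by (rule cyclic_arc_starts_cycle)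
    have stays: "tail G ` set q \<subseteq> X" if "awalk u q w" "u \<in> X" for u q w
      using that
    proof (induction q arbitrary: u)
      case (Cons a q)
      then have a: "a \<in> arcs G" "tail G a = u" "awalk (head G a) q w"
        by (auto simp: awalk_Cons_iff)
      moreover have "head G a \<in> X"
        using trap_obtain_arc[OF X \<open>u \<in> X\<close>] a by metis
      ultimately show ?case using Cons.IH Cons.prems by auto
    qed simp
    have tails: "tail G ` set (e # p) \<subseteq> X"
      using c e x stays[of "tail G e" "e # p"] by (auto simp: cycle_at_def closed_path_def)
    have arcs: "set (e # p) \<subseteq> arcs G"
      using c by (auto simp: cycle_at_def closed_path_def awalk_def)
    obtain f where f: "is_exit G f (e # p)"
      using ex c unfolding every_cycle_has_exit_def by blast
    then obtain a where a: "a \<in> set (e # p)" "tail G a = tail G f" "a \<noteq> f" "f \<in> arcs G"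
      unfolding is_exit_def by blast
    have "tail G a \<in> X" "a \<in> arcs G" using a(1) tails arcs by auto
    then show False using trap_obtain_arc[OF X \<open>tail G a \<in> X\<close>] a by metis
  qed
next
  assume notrap: "\<nexists>X. trap G (arcs G) X"
  show "every_cycle_has_exit G"
    unfolding every_cycle_has_exit_def
  proof (intro allI impI)
    fix v p assume c: "cycle_at G v p"
    then have cp: "p \<noteq> []" "awalk v p v" "closed_path G v p"
      by (auto simp: cycle_at_def closed_path_def)
    show "\<exists>f. is_exit G f p"
    proof (rule ccontr)
      assume noex: "\<nexists>f. is_exit G f p"
      have verts: "tail G ` set p = set (awalk_verts v p)"
      proof -
        have "awlast v p = v" using cp(2) by auto
        then have "head G (last p) = v" using cp(1) by (simp add: awalk_verts_conv)
        then show ?thesis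
          using closed_path_tail_mem[OF cp(3)] cp(1) by (auto simp: awalk_verts_conv)
      qed
      have "trap G (arcs G) (tail G ` set p)"
        unfolding trap_def
      proof (intro conjI ballI)
        show "tail G ` set p \<subseteq> verts G" using cp(2) by (auto simp: awalk_def)
        show "tail G ` set p \<noteq> {}" using cp(1) by simp
        fix x assume "x \<in> tail G ` set p"
        then obtain e where e: "e \<in> set p" "x = tail G e" by auto
        have "e \<in> arcs G" using e cp(2) by (auto simp: awalk_def)
        moreover have "head G e \<in> tail G ` set p"
          using awalk_verts_arc2[OF cp(2) e(1)] verts by simp
        moreover have "\<forall>f\<in>arcs G. tail G f = x \<longrightarrow> f = e"
          using noex e by (auto simp: is_exit_def)
        ultimately show "\<exists>e\<in>arcs G. tail G e = x \<and> head G e \<in> tail G ` set p \<and>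
            (\<forall>f\<in>arcs G. tail G f = x \<longrightarrow> f = e)"
          using e by blast
      qed
      with notrap show False by blast
    qed
  qed
qed

text \<open>Inside a trap a path has no choices, so it is determined by its endpoints as soon as it may
  pass through its end only once.\<close>

lemma trap_path_unique:
  assumes "trap G A X" "u \<in> X"
    and "awalk u p v" "set p \<subseteq> A" "v \<notin> tail G ` set p"
    and "awalk u q v" "set q \<subseteq> A" "v \<notin> tail G ` set q"
  shows "p = q"
  using assms(2-)
proof (induction p arbitrary: u q)
  case Nil
  then show ?case by (cases q) (auto simp: awalk_simps)
next
  case (Cons e p)
  show ?case
  proof (cases q)
    case Nil
    with Cons.prems show ?thesis by (auto simp: awalk_simps)
  next
    case (Cons f q')
    obtain g where g: "head G g \<in> X" "\<And>h. h \<in> A \<Longrightarrow> tail G h = u \<Longrightarrow> h = g"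
      using trap_obtain_arc[OF assms(1) \<open>u \<in> X\<close>] by metis
    have "e = g" "f = g" using Cons.prems Cons g(2) by (auto simp: awalk_Cons_iff)
    moreover have "p = q'"
      using Cons.prems Cons g(1) \<open>e = g\<close> \<open>f = g\<close>
      by (intro Cons.IH[of "head G g"]) (auto simp: awalk_Cons_iff)
    ultimately show ?thesis using Cons by simp
  qed
qed

text \<open>A vertex with two cyclic arcs in its own strongly connected component yields two closed simple
  paths at every vertex \<open>v\<close> of that component: go from \<open>v\<close> to the branching vertex, leave it by
  either arc and return to \<open>v\<close>.\<close>

lemma two_closed_simple_paths:
  assumes vx: "v \<rightarrow>\<^sup>* x" and xv: "x \<rightarrow>\<^sup>* v"
    and e: "e \<in> cyclic_arcs G" "tail G e = x"
    and f: "f \<in> cyclic_arcs G" "tail G f = x" and "e \<noteq> f"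
  obtains p q where "p \<noteq> q" "closed_simple_path G v p" "closed_simple_path G v q"
proof -
  obtain p where p: "apath v p x" using vx reachable_apath by auto
  have csp: "\<exists>q. closed_simple_path G v (p @ g # q)"
    if g: "g \<in> cyclic_arcs G" "tail G g = x" for g
  proof -
    have "head G g \<rightarrow>\<^sup>* v"
      using g xv by (auto simp: cyclic_arcs_def intro: reachable_trans)
    then obtain q where q: "apath (head G g) q v" using reachable_apath by auto
    have garc: "g \<in> arcs G" using g(1) by (simp add: cyclic_arcs_def)
    have tq: "v \<notin> tail G ` set q" by (rule apath_tails(2)[OF q])
    have wq: "awalk (head G g) q v" by (rule awalkI_apath[OF q])
    have "closed_simple_path G v (p @ g # q)"
    proof (cases p)
      case Nil
      then have "v = x" using p by (simp add: apath_Nil_iff)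
      then show ?thesis using Nil garc g tq wq by (simp add: closed_simple_path_Cons_iff)
    next
      case (Cons a p')
      have a: "a \<in> arcs G" "tail G a = v" "apath (head G a) p' x"
        "v \<notin> set (awalk_verts (head G a) p')"
        using p Cons by (auto simp: apath_Cons_iff)
      have w: "awalk (head G a) p' x" by (rule awalkI_apath[OF a(3)])
      have "awalk (head G a) (p' @ g # q) v"
        using w wq garc g by (auto intro!: awalk_appendI simp: awalk_Cons_iff)
      moreover have "v \<noteq> x" using apath_nonempty_ends[OF p] Cons by simp
      moreover have "v \<notin> tail G ` set p'" using a(4) awalk_tails_subset[OF w] by blast
      ultimately show ?thesis
        using Cons a tq g by (auto simp: closed_simple_path_Cons_iff)
    qed
    then show ?thesis ..
  qed
  obtain q1 q2 where "closed_simple_path G v (p @ e # q1)" "closed_simple_path G v (p @ f # q2)"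
    using csp[OF e] csp[OF f] by auto
  with \<open>e \<noteq> f\<close> that[of "p @ e # q1" "p @ f # q2"] show thesis by simp
qed

text \<open>If \<open>v\<close> lies on a closed path but has only one closed simple path, its strongly connected
  component is a single cycle, hence a trap for the cyclic arcs. Conversely a vertex of such a trap
  lies on a cycle but, closed paths at it being forced, has only one closed simple path.\<close>

lemma condition_K_iff: "condition_K G \<longleftrightarrow> (\<nexists>X. trap G (cyclic_arcs G) X)"
proof
  assume K: "condition_K G"
  show "\<nexists>X. trap G (cyclic_arcs G) X"
  proof
    assume "\<exists>X. trap G (cyclic_arcs G) X"
    then obtain X where X: "trap G (cyclic_arcs G) X" ..
    then obtain v where v: "v \<in> X" "v \<in> verts G" unfolding trap_def by auto
    obtain e where e: "e \<in> cyclic_arcs G" "tail G e = v"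
      using trap_obtain_arc[OF X v(1)] by metis
    obtain c where c: "closed_simple_path G v (e # c)"
      using cyclic_arc_starts_cycle[OF e(1)] e(2) cycle_imp_closed_simple_path by metis
    moreover have "v \<in> set (awalk_verts v (e # c))" using e(2) by simp
    ultimately obtain p q where pq: "p \<noteq> q" "closed_simple_path G v p" "closed_simple_path G v q"
      using K v(2) unfolding condition_K_def by blast
    have "r = e # c" if r: "closed_simple_path G v r" for r
    proof -
      obtain f r' where fr: "r = f # r'"
        using r by (cases r) (auto simp: closed_simple_path_def closed_path_def)
      have cyc: "set r \<subseteq> cyclic_arcs G" "set (e # c) \<subseteq> cyclic_arcs G"
        using r c closed_path_arc_cyclic unfolding closed_simple_path_def by blast+
      have "f = e \<and> head G e \<in> X"
        using trap_obtain_arc[OF X v(1)] cyc r e fr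
        by (metis closed_simple_path_Cons_iff list.set_intros(1) subsetD)
      moreover have "r' = c"
        using calculation cyc r c fr
        by (intro trap_path_unique[OF X, of "head G e" r' v c])
           (auto simp: closed_simple_path_Cons_iff)
      ultimately show ?thesis using fr by simp
    qed
    with pq show False by metis
  qed
next
  assume notrap: "\<nexists>X. trap G (cyclic_arcs G) X"
  show "condition_K G"
    unfolding condition_K_def
  proof (intro ballI impI)
    fix v assume v: "v \<in> verts G"
    assume "\<exists>u p. closed_simple_path G u p \<and> v \<in> set (awalk_verts u p)"
    then obtain u p where p: "closed_path G u p" "v \<in> set (awalk_verts u p)"
      unfolding closed_simple_path_def by blast
    have "p \<noteq> []" "awlast u p = u" using p(1) by (auto simp: closed_path_def)
    then have "v \<in> tail G ` set p"
      using p(2) closed_path_tail_mem[OF p(1)] by (auto simp: awalk_verts_conv)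
    then obtain a where a: "a \<in> cyclic_arcs G" "tail G a = v"
      using closed_path_arc_cyclic[OF p(1)] by auto
    define X where "X = {x. v \<rightarrow>\<^sup>* x \<and> x \<rightarrow>\<^sup>* v}"
    have emits: "\<exists>e\<in>cyclic_arcs G. tail G e = x \<and> head G e \<in> X" if x: "x \<in> X" for x
    proof -
      have "x \<rightarrow>\<^sup>* v" "v \<rightarrow>\<^sup>* x" using x by (auto simp: X_def)
      moreover have "v \<rightarrow>\<^sup>* head G a" "head G a \<rightarrow>\<^sup>* v"
        using a arc_reachable[of a] by (auto simp: cyclic_arcs_def)
      \<comment> \<open>The detour through \<open>a\<close> makes the walk from \<open>x\<close> to \<open>v\<close> nonempty also for \<open>x = v\<close>.\<close>
      moreover have "v \<rightarrow>\<^sup>+ head G a"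
        using a in_arcs_imp_in_arcs_ends[of a] by (auto simp: cyclic_arcs_def)
      ultimately have "x \<rightarrow>\<^sup>+ v"
        by (meson reachable1_reachable_trans reachable_reachable1_trans)
      then obtain q where "awalk x q v" "q \<noteq> []" using reachable1_awalk by auto
      then obtain e where e: "e \<in> arcs G" "tail G e = x" "head G e \<rightarrow>\<^sup>* v"
        by (cases q) (auto simp: awalk_Cons_iff intro: reachable_awalkI)
      then have "head G e \<rightarrow>\<^sup>* x" "v \<rightarrow>\<^sup>* head G e"
        using \<open>v \<rightarrow>\<^sup>* x\<close> arc_reachable[of e] by (auto intro: reachable_trans)
      with e show ?thesis by (auto simp: cyclic_arcs_def X_def)
    qed
    have "X \<subseteq> verts G" "X \<noteq> {}" using v by (auto simp: X_def dest: reachable_in_verts)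
    with notrap have "\<not> (\<forall>x\<in>X. \<exists>e\<in>cyclic_arcs G. tail G e = x \<and> head G e \<in> X \<and>
        (\<forall>f\<in>cyclic_arcs G. tail G f = x \<longrightarrow> f = e))"
      unfolding trap_def by blast
    then obtain x e f where x: "x \<in> X" and "e \<in> cyclic_arcs G" "tail G e = x"
      "f \<in> cyclic_arcs G" "tail G f = x" "e \<noteq> f"
      using emits by metis
    moreover have "v \<rightarrow>\<^sup>* x" "x \<rightarrow>\<^sup>* v" using x by (auto simp: X_def)
    ultimately show "\<exists>p q. p \<noteq> q \<and> closed_simple_path G v p \<and> closed_simple_path G v q"
      by (metis two_closed_simple_paths)
  qed
qed

end

section \<open>Automorphisms and reachability\<close>

locale graph_automorphism = wf_digraph G for G :: "('a, 'b) pre_digraph" (structure) +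
  fixes \<sigma>0 :: "'a \<Rightarrow> 'a" and \<sigma>1 :: "'b \<Rightarrow> 'b"
  assumes automorphism: "digraph_automorphism G \<sigma>0 \<sigma>1"
begin

lemma bij_verts: "bij_betw \<sigma>0 (verts G) (verts G)"
  and bij_arcs: "bij_betw \<sigma>1 (arcs G) (arcs G)"
  and tail_map: "e \<in> arcs G \<Longrightarrow> tail G (\<sigma>1 e) = \<sigma>0 (tail G e)"
  and head_map: "e \<in> arcs G \<Longrightarrow> head G (\<sigma>1 e) = \<sigma>0 (head G e)"
  using automorphism by (auto simp: digraph_automorphism_def)

lemma vert_map: "x \<in> verts G \<Longrightarrow> \<sigma>0 x \<in> verts G"
  using bij_verts by (auto simp: bij_betw_def)

lemma arc_map: "e \<in> arcs G \<Longrightarrow> \<sigma>1 e \<in> arcs G"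
  using bij_arcs by (auto simp: bij_betw_def)

lemma vert_map_eq_iff: "x \<in> verts G \<Longrightarrow> y \<in> verts G \<Longrightarrow> \<sigma>0 x = \<sigma>0 y \<longleftrightarrow> x = y"
  using bij_verts by (auto simp: bij_betw_def inj_on_eq_iff)

lemma arc_unmap:
  assumes "e \<in> arcs G"
  obtains e' where "e' \<in> arcs G" "e = \<sigma>1 e'"
  using assms bij_arcs by (auto simp: bij_betw_def)

lemma vert_funpow: "x \<in> verts G \<Longrightarrow> (\<sigma>0 ^^ k) x \<in> verts G"
  by (induction k) (auto intro: vert_map)

lemma arc_funpow:
  assumes "e \<in> arcs G"
  shows "(\<sigma>1 ^^ k) e \<in> arcs G"
    and "tail G ((\<sigma>1 ^^ k) e) = (\<sigma>0 ^^ k) (tail G e)"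
    and "head G ((\<sigma>1 ^^ k) e) = (\<sigma>0 ^^ k) (head G e)"
proof (induction k)
  case (Suc k)
  { case 1 show ?case using Suc by (simp add: arc_map) }
  { case 2 show ?case using Suc by (simp add: tail_map) }
  { case 3 show ?case using Suc by (simp add: head_map) }
qed (use assms in simp_all)

lemma reachable_map:
  assumes "x \<rightarrow>\<^sup>* y"
  shows "\<sigma>0 x \<rightarrow>\<^sup>* \<sigma>0 y"
  using assms
proof (induction rule: reachable_induct)
  case base
  then show ?case by (simp add: vert_map)
next
  case (step y z)
  from \<open>y \<rightarrow> z\<close> obtain e where e: "e \<in> arcs G" "tail G e = y" "head G e = z" by blast
  then have "\<sigma>0 y \<rightarrow>\<^sup>* \<sigma>0 z"
    using arc_reachable[OF arc_map[OF e(1)]] by (simp add: tail_map head_map)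
  with step.IH show ?case by (rule reachable_trans)
qed

lemma reachable_map_funpow: "x \<rightarrow>\<^sup>* y \<Longrightarrow> (\<sigma>0 ^^ k) x \<rightarrow>\<^sup>* (\<sigma>0 ^^ k) y"
  by (induction k) (auto intro: reachable_map)

lemma reachable_from_map:
  assumes "\<sigma>0 x \<rightarrow>\<^sup>* w" "x \<in> verts G"
  shows "\<exists>y. w = \<sigma>0 y \<and> x \<rightarrow>\<^sup>* y"
  using assms(1)
proof (induction rule: reachable_induct)
  case base
  then show ?case using assms(2) by auto
next
  case (step w z)
  then obtain y where y: "w = \<sigma>0 y" "x \<rightarrow>\<^sup>* y" by blast
  from \<open>w \<rightarrow> z\<close> obtain e where e: "e \<in> arcs G" "tail G e = w" "head G e = z" by blast
  obtain e' where e': "e' \<in> arcs G" "e = \<sigma>1 e'" using e(1) by (rule arc_unmap)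
  have "tail G e' = y"
    using e e' y reachable_in_verts(2)[OF y(2)] by (simp add: tail_map vert_map_eq_iff)
  then have "x \<rightarrow>\<^sup>* head G e'" using y(2) arc_reachable[OF e'(1)] by (auto intro: reachable_trans)
  moreover have "z = \<sigma>0 (head G e')" using e e' by (simp add: head_map)
  ultimately show ?case by blast
qed

lemma arcs_image: "\<sigma>1 ` arcs G = arcs G"
  using bij_arcs by (simp add: bij_betw_def)

lemma cyclic_arcs_image: "\<sigma>1 ` cyclic_arcs G = cyclic_arcs G"
proof
  show "\<sigma>1 ` cyclic_arcs G \<subseteq> cyclic_arcs G"
    by (auto simp: cyclic_arcs_def arc_map tail_map head_map reachable_map)
  show "cyclic_arcs G \<subseteq> \<sigma>1 ` cyclic_arcs G"
  proof
    fix e assume e: "e \<in> cyclic_arcs G"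
    then have "e \<in> arcs G" by (simp add: cyclic_arcs_def)
    then obtain e' where e': "e' \<in> arcs G" "e = \<sigma>1 e'" by (rule arc_unmap)
    have "\<sigma>0 (head G e') \<rightarrow>\<^sup>* \<sigma>0 (tail G e')"
      using e e' by (simp add: cyclic_arcs_def tail_map head_map)
    then obtain y where y: "\<sigma>0 (tail G e') = \<sigma>0 y" "head G e' \<rightarrow>\<^sup>* y"
      using reachable_from_map[of "head G e'"] e'(1) by auto
    then have "tail G e' = y"
      using e'(1) reachable_in_verts(2)[OF y(2)] by (simp add: vert_map_eq_iff)
    with y e' show "e \<in> \<sigma>1 ` cyclic_arcs G" by (auto simp: cyclic_arcs_def)
  qed
qed

text \<open>Let \<open>R\<close> be the set of vertices reachable from \<open>x\<close>. Translation by \<open>\<sigma>0 ^^ m\<close> maps \<open>R\<close> to vertices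
  reachable from \<open>(\<sigma>0 ^^ m) x\<close>, hence into \<open>R\<close>, and being injective on the finite set \<open>R\<close> it maps \<open>R\<close>
  onto \<open>R\<close>. So \<open>x\<close> itself is reachable from \<open>(\<sigma>0 ^^ m) x\<close>.\<close>

lemma translate_reaches_back:
  assumes fin: "finite (verts G)" and reach: "x \<rightarrow>\<^sup>* (\<sigma>0 ^^ m) x"
  shows "(\<sigma>0 ^^ m) x \<rightarrow>\<^sup>* x"
proof -
  define R where "R = {y. x \<rightarrow>\<^sup>* y}"
  have "(\<sigma>0 ^^ m) ` R \<subseteq> R"
    using reach by (auto simp: R_def intro: reachable_trans reachable_map_funpow)
  moreover have "inj_on (\<sigma>0 ^^ m) R"
    using bij_betw_imp_inj_on[OF bij_betw_funpow[OF bij_verts]]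
    by (rule inj_on_subset) (auto simp: R_def dest: reachable_in_verts)
  moreover have "finite R" unfolding R_def by (rule reachable_finite[OF fin])
  ultimately have "(\<sigma>0 ^^ m) ` R = R" by (intro endo_inj_surj)
  moreover have "x \<in> R" using reachable_in_verts(1)[OF reach] by (simp add: R_def)
  ultimately have "x \<in> (\<sigma>0 ^^ m) ` R" by simp
  then obtain y where "x = (\<sigma>0 ^^ m) y" "x \<rightarrow>\<^sup>* y" by (auto simp: R_def)
  then show ?thesis by (metis reachable_map_funpow)
qed

end

section \<open>Moving heads within orbits\<close>

text \<open>The relation between a graph and its twist, in a form that holds in both directions, so that
  each inclusion below has to be proved only once.\<close>

locale heads_in_orbits =
  G: graph_automorphism G \<sigma>0 \<sigma>1 + H: graph_automorphism H \<sigma>0 \<sigma>1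
  for G H :: "('a, 'b) pre_digraph" and \<sigma>0 \<sigma>1 +
  assumes same_verts: "verts H = verts G"
    and same_arcs: "arcs H = arcs G"
    and same_tail: "tail H = tail G"
    and head_orbit: "e \<in> arcs G \<Longrightarrow> \<exists>k. head H e = (\<sigma>0 ^^ k) (head G e)"
    and finite_verts: "finite (verts G)"
begin

lemma reachable_translate:
  assumes "x \<rightarrow>\<^sup>*\<^bsub>G\<^esub> y"
  shows "\<exists>k. x \<rightarrow>\<^sup>*\<^bsub>H\<^esub> (\<sigma>0 ^^ k) y"
  using assms
proof (induction rule: G.reachable_induct)
  case base
  then have "x \<rightarrow>\<^sup>*\<^bsub>H\<^esub> (\<sigma>0 ^^ 0) x" using same_verts by simp
  then show ?case ..
next
  case (step y z)
  then obtain k where k: "x \<rightarrow>\<^sup>*\<^bsub>H\<^esub> (\<sigma>0 ^^ k) y" by blast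
  from \<open>y \<rightarrow>\<^bsub>G\<^esub> z\<close> obtain e where e: "e \<in> arcs G" "tail G e = y" "head G e = z" by blast
  obtain j where j: "head H e = (\<sigma>0 ^^ j) z" using head_orbit[OF e(1)] e(3) by auto
  have eH: "e \<in> arcs H" using e(1) same_arcs by simp
  \<comment> \<open>The next arc has to start at the translate of \<open>y\<close>, so \<open>e\<close> is translated as well.\<close>
  have "(\<sigma>0 ^^ k) y \<rightarrow>\<^sup>*\<^bsub>H\<^esub> (\<sigma>0 ^^ k) ((\<sigma>0 ^^ j) z)"
    using H.arc_reachable[OF H.arc_funpow(1)[OF eH, of k]] H.arc_funpow(2,3)[OF eH, of k]
      e(2) j same_tail by simp
  with k have "x \<rightarrow>\<^sup>*\<^bsub>H\<^esub> (\<sigma>0 ^^ (k + j)) z"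
    by (auto simp: funpow_add intro: H.reachable_trans)
  then show ?case ..
qed

lemma cyclic_arcs_subset: "cyclic_arcs G \<subseteq> cyclic_arcs H"
proof
  fix e assume "e \<in> cyclic_arcs G"
  then have e: "e \<in> arcs G" "head G e \<rightarrow>\<^sup>*\<^bsub>G\<^esub> tail G e" by (auto simp: cyclic_arcs_def)
  then have eH: "e \<in> arcs H" using same_arcs by simp
  obtain i where i: "head H e = (\<sigma>0 ^^ i) (head G e)" using head_orbit[OF e(1)] ..
  obtain k where k: "head G e \<rightarrow>\<^sup>*\<^bsub>H\<^esub> (\<sigma>0 ^^ k) (tail G e)" using reachable_translate[OF e(2)] ..
  have to: "head H e \<rightarrow>\<^sup>*\<^bsub>H\<^esub> (\<sigma>0 ^^ (i + k)) (tail H e)"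
    using H.reachable_map_funpow[OF k, of i] i same_tail by (simp add: funpow_add)
  with H.arc_reachable[OF eH] have "tail H e \<rightarrow>\<^sup>*\<^bsub>H\<^esub> (\<sigma>0 ^^ (i + k)) (tail H e)"
    by (rule H.reachable_trans)
  then have "(\<sigma>0 ^^ (i + k)) (tail H e) \<rightarrow>\<^sup>*\<^bsub>H\<^esub> tail H e"
    using H.translate_reaches_back finite_verts same_verts by simp
  with to have "head H e \<rightarrow>\<^sup>*\<^bsub>H\<^esub> tail H e" by (rule H.reachable_trans)
  with eH show "e \<in> cyclic_arcs H" by (simp add: cyclic_arcs_def)
qed

text \<open>The translates of a trap satisfy the trap condition in \<open>G\<close> because \<open>\<sigma>1\<close> permutes \<open>A\<close>; their
  union contains with each vertex its whole orbit, so the heads stay inside it in \<open>H\<close>.\<close>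

lemma trap_translates:
  assumes X: "trap G A X" and A: "A \<subseteq> arcs G" "\<sigma>1 ` A = A"
  shows "trap H A (\<Union>k. (\<sigma>0 ^^ k) ` X)" (is "trap H A ?Y")
  unfolding trap_def
proof (intro conjI ballI)
  have XG: "X \<subseteq> verts G" "X \<noteq> {}" using X by (auto simp: trap_def)
  show "?Y \<subseteq> verts H" using XG G.vert_funpow same_verts by auto
  show "?Y \<noteq> {}" using XG by auto
  have orbit: "(\<sigma>0 ^^ j) y \<in> ?Y" if y: "y \<in> ?Y" for y j
  proof -
    obtain k x where "x \<in> X" "y = (\<sigma>0 ^^ k) x" using y by auto
    then have "(\<sigma>0 ^^ j) y = (\<sigma>0 ^^ (j + k)) x" by (simp add: funpow_add)
    with \<open>x \<in> X\<close> show ?thesis by blast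
  qed
  have translates: "\<exists>e\<in>A. tail G e = (\<sigma>0 ^^ k) x \<and> head G e \<in> ?Y \<and>
      (\<forall>f\<in>A. tail G f = (\<sigma>0 ^^ k) x \<longrightarrow> f = e)" if x: "x \<in> X" for k x
  proof (induction k)
    case 0
    obtain e where e: "e \<in> A" "tail G e = x" "head G e \<in> X"
      "\<And>f. f \<in> A \<Longrightarrow> tail G f = x \<Longrightarrow> f = e"
      using trap_obtain_arc[OF X x] by metis
    from e(3) have "head G e \<in> ?Y" by (intro UN_I[of 0]) simp_all
    with e(1,2,4) show ?case unfolding funpow_0 by blast
  next
    case (Suc k)
    then obtain e where e: "e \<in> A" "tail G e = (\<sigma>0 ^^ k) x" "head G e \<in> ?Y"
      "\<forall>f\<in>A. tail G f = (\<sigma>0 ^^ k) x \<longrightarrow> f = e" by blast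
    have eG: "e \<in> arcs G" using e(1) A(1) by auto
    have "\<sigma>1 e \<in> A" using e(1) A(2) by auto
    moreover have "tail G (\<sigma>1 e) = (\<sigma>0 ^^ Suc k) x" using eG e(2) by (simp add: G.tail_map)
    moreover have "head G (\<sigma>1 e) \<in> ?Y"
      using orbit[OF e(3), of 1] eG by (simp add: G.head_map)
    moreover have "f = \<sigma>1 e" if f: "f \<in> A" "tail G f = (\<sigma>0 ^^ Suc k) x" for f
    proof -
      obtain f' where f': "f' \<in> A" "f = \<sigma>1 f'" using f(1) A(2) by auto
      then have f'G: "f' \<in> arcs G" using A(1) by auto
      then have "\<sigma>0 (tail G f') = \<sigma>0 (tail G e)" using f(2) f'(2) e(2) by (simp add: G.tail_map)
      then have "tail G f' = tail G e" using f'G eG by (simp add: G.vert_map_eq_iff)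
      with e(2,4) f' show ?thesis by metis
    qed
    ultimately show ?case by blast
  qed
  fix y assume "y \<in> ?Y"
  then obtain k x where "x \<in> X" "y = (\<sigma>0 ^^ k) x" by auto
  with translates[of x k] obtain e where e: "e \<in> A" "tail G e = y" "head G e \<in> ?Y"
    "\<forall>f\<in>A. tail G f = y \<longrightarrow> f = e" by blast
  obtain j where "head H e = (\<sigma>0 ^^ j) (head G e)" using head_orbit e(1) A(1) by blast
  then have "head H e \<in> ?Y" using orbit[OF e(3), of j] by simp
  with e(1,2,4) show "\<exists>e\<in>A. tail H e = y \<and> head H e \<in> ?Y \<and> (\<forall>f\<in>A. tail H f = y \<longrightarrow> f = e)"
    unfolding same_tail by (intro bexI[of _ e] conjI)
qed

end

section \<open>The twisted graph\<close>

lemma twisted_graph_simps [simp]: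
  "verts (twisted_graph G \<sigma>0) = verts G"
  "arcs (twisted_graph G \<sigma>0) = arcs G"
  "tail (twisted_graph G \<sigma>0) = tail G"
  "head (twisted_graph G \<sigma>0) e = the_inv_into (verts G) \<sigma>0 (head G e)"
  by (simp_all add: twisted_graph_def)

context graph_automorphism
begin

lemma twisted_head:
  assumes "e \<in> arcs G"
  shows "head (twisted_graph G \<sigma>0) e \<in> verts G"
    and "\<sigma>0 (head (twisted_graph G \<sigma>0) e) = head G e"
proof -
  have *: "inj_on \<sigma>0 (verts G)" "head G e \<in> \<sigma>0 ` verts G"
    using bij_verts assms by (auto simp: bij_betw_def)
  show "head (twisted_graph G \<sigma>0) e \<in> verts G"
    using the_inv_into_into[OF * order_refl] by simp
  show "\<sigma>0 (head (twisted_graph G \<sigma>0) e) = head G e"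
    using f_the_inv_into_f[OF *] by simp
qed

lemma twisted_graph_automorphism: "graph_automorphism (twisted_graph G \<sigma>0) \<sigma>0 \<sigma>1"
proof
  have "head (twisted_graph G \<sigma>0) (\<sigma>1 e) = \<sigma>0 (head (twisted_graph G \<sigma>0) e)"
    if e: "e \<in> arcs G" for e
  proof -
    have "\<sigma>0 (head (twisted_graph G \<sigma>0) (\<sigma>1 e)) = \<sigma>0 (\<sigma>0 (head (twisted_graph G \<sigma>0) e))"
      using twisted_head(2)[OF arc_map[OF e]] twisted_head(2)[OF e] head_map[OF e] by metis
    then show ?thesis
      using twisted_head(1)[OF arc_map[OF e]] vert_map[OF twisted_head(1)[OF e]] vert_map_eq_iff
      by blast
  qed
  then show "digraph_automorphism (twisted_graph G \<sigma>0) \<sigma>0 \<sigma>1"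
    unfolding digraph_automorphism_def twisted_graph_simps(1-3)
    using bij_verts bij_arcs tail_map by blast
next
  fix e assume "e \<in> arcs (twisted_graph G \<sigma>0)"
  then have e: "e \<in> arcs G" by simp
  then show "tail (twisted_graph G \<sigma>0) e \<in> verts (twisted_graph G \<sigma>0)" by simp
  show "head (twisted_graph G \<sigma>0) e \<in> verts (twisted_graph G \<sigma>0)"
    using twisted_head(1)[OF e] by simp
qed

text \<open>On a finite set of vertices, \<open>\<sigma>0\<close> permutes each forward orbit, so its inverse is given
  there by translates as well.\<close>

lemma funpow_undoes_map:
  assumes "finite (verts G)" "y \<in> verts G"
  shows "\<exists>k. y = (\<sigma>0 ^^ k) (\<sigma>0 y)"
proof -
  define Orb where "Orb = range (\<lambda>k. (\<sigma>0 ^^ k) y)"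
  have sub: "Orb \<subseteq> verts G" using vert_funpow[OF assms(2)] by (auto simp: Orb_def)
  have "\<sigma>0 ` Orb \<subseteq> Orb"
  proof
    fix z assume "z \<in> \<sigma>0 ` Orb"
    then obtain k where "z = (\<sigma>0 ^^ Suc k) y" by (auto simp: Orb_def)
    then show "z \<in> Orb" unfolding Orb_def by blast
  qed
  moreover have "inj_on \<sigma>0 Orb"
    using bij_betw_imp_inj_on[OF bij_verts] sub by (rule inj_on_subset)
  ultimately have "\<sigma>0 ` Orb = Orb"
    using finite_subset[OF sub assms(1)] by (intro endo_inj_surj)
  moreover have "y \<in> Orb" unfolding Orb_def by (rule range_eqI[of _ _ 0]) simp
  ultimately obtain k where "y = \<sigma>0 ((\<sigma>0 ^^ k) y)" by (auto simp: Orb_def)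
  then show ?thesis by (auto simp: funpow_swap1)
qed

lemma twisted_heads_in_orbits:
  assumes fin: "finite (verts G)"
  shows "heads_in_orbits G (twisted_graph G \<sigma>0) \<sigma>0 \<sigma>1"
    and "heads_in_orbits (twisted_graph G \<sigma>0) G \<sigma>0 \<sigma>1"
proof -
  interpret T: graph_automorphism "twisted_graph G \<sigma>0" \<sigma>0 \<sigma>1
    by (rule twisted_graph_automorphism)
  show "heads_in_orbits G (twisted_graph G \<sigma>0) \<sigma>0 \<sigma>1"
  proof
    fix e assume e: "e \<in> arcs G"
    show "\<exists>k. head (twisted_graph G \<sigma>0) e = (\<sigma>0 ^^ k) (head G e)"
      using funpow_undoes_map[OF fin twisted_head(1)[OF e]] twisted_head(2)[OF e] by simp
  qed (use fin in simp_all)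
  show "heads_in_orbits (twisted_graph G \<sigma>0) G \<sigma>0 \<sigma>1"
  proof
    fix e assume e: "e \<in> arcs (twisted_graph G \<sigma>0)"
    have "head G e = (\<sigma>0 ^^ 1) (head (twisted_graph G \<sigma>0) e)"
      using twisted_head(2)[of e] e by simp
    then show "\<exists>k. head G e = (\<sigma>0 ^^ k) (head (twisted_graph G \<sigma>0) e)" ..
  qed (use fin in simp_all)
qed

end

theorem corollary4p5:
  fixes E :: "('a, 'b) pre_digraph" and \<sigma>0 :: "'a \<Rightarrow> 'a" and \<sigma>1 :: "'b \<Rightarrow> 'b"
  assumes "wf_digraph E"
    and "finite (verts E)"
    and "digraph_automorphism E \<sigma>0 \<sigma>1"
  shows "(acyclic_graph E \<longleftrightarrow> acyclic_graph (twisted_graph E \<sigma>0)) \<and>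
    (every_cycle_has_exit E \<longleftrightarrow> every_cycle_has_exit (twisted_graph E \<sigma>0)) \<and>
    (no_exit_graph E \<longleftrightarrow> no_exit_graph (twisted_graph E \<sigma>0)) \<and>
    (condition_K E \<longleftrightarrow> condition_K (twisted_graph E \<sigma>0))"
proof -
  let ?T = "twisted_graph E \<sigma>0"
  interpret E: graph_automorphism E \<sigma>0 \<sigma>1
    using assms(1,3) by (simp add: graph_automorphism_def graph_automorphism_axioms_def)
  interpret T: graph_automorphism ?T \<sigma>0 \<sigma>1
    by (rule E.twisted_graph_automorphism)
  interpret ET: heads_in_orbits E ?T \<sigma>0 \<sigma>1
    by (rule E.twisted_heads_in_orbits(1)[OF assms(2)])
  interpret TE: heads_in_orbits ?T E \<sigma>0 \<sigma>1
    by (rule E.twisted_heads_in_orbits(2)[OF assms(2)])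
  have cyclic: "cyclic_arcs ?T = cyclic_arcs E"
    using ET.cyclic_arcs_subset TE.cyclic_arcs_subset by (rule equalityI[rotated])
  have traps: "(\<exists>X. trap E A X) \<longleftrightarrow> (\<exists>X. trap ?T A X)" if "A \<subseteq> arcs E" "\<sigma>1 ` A = A" for A
    using ET.trap_translates[OF _ that] TE.trap_translates[of A] that by auto
  have "acyclic_graph E \<longleftrightarrow> acyclic_graph ?T"
    by (simp add: E.acyclic_graph_iff T.acyclic_graph_iff cyclic)
  moreover have "every_cycle_has_exit E \<longleftrightarrow> every_cycle_has_exit ?T"
    using traps[OF order_refl E.arcs_image] assms(2)
    by (simp add: E.every_cycle_has_exit_iff T.every_cycle_has_exit_iff)
  moreover have "no_exit_graph E \<longleftrightarrow> no_exit_graph ?T"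
    by (simp add: E.no_exit_graph_iff T.no_exit_graph_iff cyclic)
  moreover have "condition_K E \<longleftrightarrow> condition_K ?T"
    using traps[OF cyclic_arcs_subset_arcs E.cyclic_arcs_image]
    by (simp add: E.condition_K_iff T.condition_K_iff cyclic)
  ultimately show ?thesis by blast
qed

end
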